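(* Let $m\geq 3$ and let $G$ be the tree on the $m+3$ vertices $o,x_1,\dots,x_m,y,z$ whose edges are $ox_1,\dots,ox_m$, $x_1y$ and $x_1z$. Let $H$ be a distance-balanced graph which contains $G$ as a spanning subgraph. Then $\mathrm{diam}(H)\leq 2$, and hence $H$ is a regular graph. Moreover, $b(G)=\frac{m^2+m-4}{2}$.
   Context: All graphs are finite and simple. For vertices $u,v$ of a graph $H$, $d_H(u,v)$ is the length of a shortest $u$–$v$ path, and $\mathrm{diam}(H)=\max_{u,v} d_H(u,v)$. For an edge $xy$ of $H$, $W^H_{xy}=\{u\in V(H): d_H(u,x)<d_H(u,y)\}$. A graph $H$ is distance-balanced if $|W^H_{xy}|=|W^H_{yx}|$ for every edge $xy$ of $H$. For a graph $G$, $b(G)$ is the smallest number of edges which can be added to $G$ (keeping the vertex set) so that the resulting graph is distance-balanced. *)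

theory Defs
  imports Complex_Main "HOL-Library.Extended_Nat"
begin

record 'a ugraph =
  verts :: "'a set"
  edges :: "'a set set"

definition simple_graph :: "'a ugraph \<Rightarrow> bool" where
  "simple_graph H \<longleftrightarrow> finite (verts H) \<and> (\<forall>e\<in>edges H. e \<subseteq> verts H \<and> card e = 2)"

definition spanning_subgraph :: "'a ugraph \<Rightarrow> 'a ugraph \<Rightarrow> bool" where
  "spanning_subgraph G H \<longleftrightarrow> verts G = verts H \<and> edges G \<subseteq> edges H"

(* A path is given by its list of vertices, so its length is "length p - 1";
   the one-vertex list is the path of length 0. *)
definition is_path :: "'a ugraph \<Rightarrow> 'a \<Rightarrow> 'a list \<Rightarrow> 'a \<Rightarrow> bool" where
  "is_path H u p v \<longleftrightarrow>
     p \<noteq> [] \<and> hd p = u \<and> last p = v \<and> distinct p \<and> set p \<subseteq> verts H \<and>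
     successively (\<lambda>a b. {a, b} \<in> edges H) p"

(* The distance is infinite if there is no path from u to v. *)
definition gdist :: "'a ugraph \<Rightarrow> 'a \<Rightarrow> 'a \<Rightarrow> enat" where
  "gdist H u v = (INF p\<in>{p. is_path H u p v}. enat (length p - 1))"

(* Meaningful for finite graphs with at least one vertex only. *)
definition diam :: "'a ugraph \<Rightarrow> enat" where
  "diam H = Max {gdist H u v | u v. u \<in> verts H \<and> v \<in> verts H}"

definition closer :: "'a ugraph \<Rightarrow> 'a \<Rightarrow> 'a \<Rightarrow> 'a set" where
  "closer H x y = {u \<in> verts H. gdist H u x < gdist H u y}"

definition distance_balanced :: "'a ugraph \<Rightarrow> bool" where
  "distance_balanced H \<longleftrightarrow>
     (\<forall>x y. {x, y} \<in> edges H \<longrightarrow> card (closer H x y) = card (closer H y x))"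

definition degree :: "'a ugraph \<Rightarrow> 'a \<Rightarrow> nat" where
  "degree H v = card {e \<in> edges H. v \<in> e}"

definition regular :: "'a ugraph \<Rightarrow> bool" where
  "regular H \<longleftrightarrow> (\<exists>r. \<forall>v\<in>verts H. degree H v = r)"

(* The set of admissible numbers is nonempty for every finite simple graph G,
   because the complete graph on "verts G" is distance-balanced. *)
definition b_number :: "'a ugraph \<Rightarrow> nat" where
  "b_number G = (LEAST k. \<exists>F. F \<inter> edges G = {} \<and> card F = k \<and>
     simple_graph \<lparr>verts = verts G, edges = edges G \<union> F\<rparr> \<and>
     distance_balanced \<lparr>verts = verts G, edges = edges G \<union> F\<rparr>)"

end

theory Submission
  imports Defs
begin

text \<open>
  In a supergraph \<open>H\<close> of the tree only the pairs \<open>x\<^sub>i, y\<close> and \<open>x\<^sub>i, z\<close> with \<open>i \<ge> 2\<close> can be at distance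
  more than 2. If \<open>x\<^sub>i\<close> and \<open>y\<close> are, then \<open>o\<close>, \<open>x\<^sub>1\<close>, \<open>y\<close> are all closer to \<open>o\<close> than to \<open>x\<^sub>i\<close>, whereas
  at most \<open>x\<^sub>i\<close> and \<open>z\<close> are closer to \<open>x\<^sub>i\<close>, because \<open>o\<close> is adjacent to every \<open>x\<^sub>j\<close>; so the edge
  \<open>o x\<^sub>i\<close> is not balanced. In diameter at most 2, an edge is balanced iff its ends have the same degree,
  so \<open>H\<close> is regular, of degree at least \<open>deg o \<ge> m\<close>, and has at least \<open>m (m + 3) / 2\<close> edges.
  Equality holds for the complement of the disjoint union of the triangle \<open>o y z\<close> and the cycle
  \<open>x\<^sub>1 \<dots> x\<^sub>m\<close>: it is \<open>m\<close>-regular, and it has diameter 2 because it is a join.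
\<close>

section \<open>Neighbourhoods, degrees and the handshake identity\<close>

definition nbrs :: "'a ugraph \<Rightarrow> 'a \<Rightarrow> 'a set" where
  "nbrs H v = {w. {v, w} \<in> edges H}"

lemma nbrs_sym: "v \<in> nbrs H u \<longleftrightarrow> u \<in> nbrs H v"
  by (simp add: nbrs_def insert_commute)

lemma nbrs_simple:
  assumes "simple_graph H" "v \<in> nbrs H u"
  shows "u \<in> verts H" "v \<in> verts H" "u \<noteq> v"
proof -
  have "{u, v} \<subseteq> verts H" "card {u, v} = 2"
    using assms by (auto simp: simple_graph_def nbrs_def)
  then show "u \<in> verts H" "v \<in> verts H" "u \<noteq> v" by auto
qed

lemma finite_nbrs:
  assumes "simple_graph H"
  shows "finite (nbrs H v)"
proof (rule finite_subset)
  show "nbrs H v \<subseteq> verts H" using nbrs_simple(2)[OF assms] by blast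
qed (use assms in \<open>simp add: simple_graph_def\<close>)

lemma finite_edges:
  assumes "simple_graph H"
  shows "finite (edges H)"
  by (rule finite_subset[of _ "Pow (verts H)"]) (use assms in \<open>auto simp: simple_graph_def\<close>)

text \<open>The map sending \<open>w\<close> to \<open>{v, w}\<close> is a bijection from the
  neighbours of \<open>v\<close> to the edges at \<open>v\<close>.\<close>

lemma degree_eq_card_nbrs:
  assumes "simple_graph H"
  shows "degree H v = card (nbrs H v)"
proof -
  have "{e \<in> edges H. v \<in> e} = (\<lambda>w. {v, w}) ` nbrs H v"
  proof (intro equalityI subsetI)
    fix e assume e: "e \<in> {e \<in> edges H. v \<in> e}"
    then have "card e = 2" using assms by (auto simp: simple_graph_def)
    then obtain w where "e = {v, w}" using e by (auto simp: card_2_iff)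
    then show "e \<in> (\<lambda>w. {v, w}) ` nbrs H v" using e by (auto simp: nbrs_def)
  qed (auto simp: nbrs_def)
  moreover have "inj_on (\<lambda>w. {v, w}) (nbrs H v)"
    by (auto simp: inj_on_def doubleton_eq_iff)
  ultimately show ?thesis by (simp add: degree_def card_image)
qed

lemma handshake:
  assumes "simple_graph H"
  shows "(\<Sum>v\<in>verts H. degree H v) = 2 * card (edges H)"
proof -
  have "\<forall>e\<in>edges H. card {v \<in> verts H. v \<in> e} = 2"
  proof
    fix e assume "e \<in> edges H"
    then have "{v \<in> verts H. v \<in> e} = e" "card e = 2" using assms by (auto simp: simple_graph_def)
    then show "card {v \<in> verts H. v \<in> e} = 2" by simp
  qed
  then show ?thesis
    unfolding degree_def using assms finite_edges[OF assms]
    by (subst sum_multicount[where k = 2]) (auto simp: simple_graph_def)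
qed

section \<open>Distances up to two\<close>

text \<open>An infimum lies strictly below a bound iff some member does, which also covers the case
  of no path. A list counts vertices, so fewer than \<open>Suc k\<close> edges means at most
  \<open>Suc k\<close> entries.\<close>

lemma gdist_less_iff:
  "gdist H u v < enat (Suc k) \<longleftrightarrow> (\<exists>p. is_path H u p v \<and> length p \<le> Suc k)"
  by (auto simp: gdist_def INF_less_iff less_Suc_eq_le)

lemma gdist_less_1_iff: "gdist H u v < 1 \<longleftrightarrow> u = v \<and> u \<in> verts H"
proof -
  have "gdist H u v < enat (Suc 0) \<longleftrightarrow> u = v \<and> u \<in> verts H"
    unfolding gdist_less_iff
  proof
    assume "\<exists>p. is_path H u p v \<and> length p \<le> Suc 0"
    then obtain p where p: "is_path H u p v" "length p \<le> Suc 0" by blast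
    then obtain a where "p = [a]" by (auto simp: is_path_def le_Suc_eq length_Suc_conv)
    then show "u = v \<and> u \<in> verts H" using p(1) by (auto simp: is_path_def)
  next
    assume "u = v \<and> u \<in> verts H"
    then have "is_path H u [u] v" by (auto simp add: is_path_def)
    then show "\<exists>p. is_path H u p v \<and> length p \<le> Suc 0" by force
  qed
  then show ?thesis by (simp add: one_enat_def)
qed

lemma gdist_less_2_iff:
  assumes "simple_graph H"
  shows "gdist H u v < 2 \<longleftrightarrow> u = v \<and> u \<in> verts H \<or> v \<in> nbrs H u"
proof -
  have "gdist H u v < enat (Suc 1) \<longleftrightarrow> u = v \<and> u \<in> verts H \<or> v \<in> nbrs H u"
    unfolding gdist_less_iff
  proof
    assume "\<exists>p. is_path H u p v \<and> length p \<le> Suc 1"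
    then obtain p where p: "is_path H u p v" "length p \<le> Suc 1" by blast
    then consider a where "p = [a]" | a b where "p = [a, b]"
      by (auto simp: is_path_def le_Suc_eq length_Suc_conv)
    then show "u = v \<and> u \<in> verts H \<or> v \<in> nbrs H u"
      using p(1) by cases (auto simp: is_path_def nbrs_def)
  next
    assume "u = v \<and> u \<in> verts H \<or> v \<in> nbrs H u"
    then have "is_path H u [u] v \<or> is_path H u [u, v] v"
      using nbrs_simple[OF assms, of v u] by (auto simp: is_path_def nbrs_def)
    then show "\<exists>p. is_path H u p v \<and> length p \<le> Suc 1" by force
  qed
  then show ?thesis by (simp add: numeral_eq_enat numeral_2_eq_2)
qed

lemma gdist_le_2_iff:
  assumes "simple_graph H"
  shows "gdist H u v \<le> 2 \<longleftrightarrow>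
    u = v \<and> u \<in> verts H \<or> v \<in> nbrs H u \<or> nbrs H u \<inter> nbrs H v \<noteq> {}"
proof -
  let ?R = "u = v \<and> u \<in> verts H \<or> v \<in> nbrs H u \<or> nbrs H u \<inter> nbrs H v \<noteq> {}"
  have "gdist H u v < enat (Suc 2) \<longleftrightarrow> ?R"
    unfolding gdist_less_iff
  proof
    assume "\<exists>p. is_path H u p v \<and> length p \<le> Suc 2"
    then obtain p where p: "is_path H u p v" "length p \<le> Suc 2" by blast
    then consider a where "p = [a]" | a b where "p = [a, b]" | a b d where "p = [a, b, d]"
      by (auto simp: is_path_def le_Suc_eq length_Suc_conv numeral_2_eq_2)
    then show ?R
      using p(1) by cases (auto simp: is_path_def nbrs_def insert_commute)
  next
    assume R: ?R
    show "\<exists>p. is_path H u p v \<and> length p \<le> Suc 2"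
    proof (cases "u = v \<and> u \<in> verts H \<or> v \<in> nbrs H u")
      case True
      then have "is_path H u [u] v \<or> is_path H u [u, v] v"
        using nbrs_simple[OF assms, of v u] by (auto simp: is_path_def nbrs_def)
      then show ?thesis by force
    next
      case False
      then obtain w where w: "w \<in> nbrs H u" "w \<in> nbrs H v" using R by blast
      \<comment> \<open>Needed for \<open>[u, w, v]\<close> to be distinct: if \<open>u = v\<close>,
        then \<open>u\<close>, having a neighbour, is a vertex, contrary to
        \<open>False\<close>.\<close>
      then have "u \<noteq> v" using False nbrs_simple[OF assms w(1)] by auto
      then have "is_path H u [u, w, v] v"
        using w nbrs_simple[OF assms w(1)] nbrs_simple[OF assms w(2)]
        by (auto simp: is_path_def nbrs_def insert_commute)
      then show ?thesis by force
    qed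
  qed
  \<comment> \<open>Extended naturals have no value strictly between 2 and 3.\<close>
  moreover have "gdist H u v \<le> 2 \<longleftrightarrow> gdist H u v < enat (Suc 2)"
    by (cases "gdist H u v") (auto simp: numeral_eq_enat)
  ultimately show ?thesis by simp
qed

lemma diam_le_iff:
  assumes "simple_graph H" "verts H \<noteq> {}"
  shows "diam H \<le> k \<longleftrightarrow> (\<forall>u\<in>verts H. \<forall>v\<in>verts H. gdist H u v \<le> k)"
proof -
  have "finite {gdist H u v | u v. u \<in> verts H \<and> v \<in> verts H}"
    using assms by (intro finite_image_set2) (auto simp: simple_graph_def)
  then show ?thesis
    unfolding diam_def using assms(2) by (subst Max_le_iff) auto
qed

section \<open>Distance-balanced graphs of diameter at most two\<close>

locale diam2_graph =
  fixes H :: "'a ugraph"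
  assumes simple: "simple_graph H"
    and dist_le: "\<And>u v. u \<in> verts H \<Longrightarrow> v \<in> verts H \<Longrightarrow> gdist H u v \<le> 2"
begin

text \<open>All distances are 0, 1 or 2, so a vertex closer to \<open>u\<close> than to
  \<open>v\<close> is \<open>u\<close> itself or is at distance 1 from \<open>u\<close> and 2 from
  \<open>v\<close>.\<close>

lemma closer_eq:
  assumes "v \<in> nbrs H u"
  shows "closer H u v = insert u (nbrs H u - nbrs H v - {v})"
proof -
  note uv = nbrs_simple[OF simple assms]
  have "gdist H w u < gdist H w v \<longleftrightarrow> w = u \<or> w \<in> nbrs H u \<and> w \<notin> nbrs H v \<and> w \<noteq> v"
    if w: "w \<in> verts H" for w
  proof -
    have le: "gdist H w u \<le> 2" "gdist H w v \<le> 2" using dist_le uv w by auto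
    \<comment> \<open>Among values up to 2, a strict inequality is witnessed by one of the
      thresholds 1 and 2, and both are characterised above.\<close>
    have *: "a < b \<longleftrightarrow> (a < 1 \<and> \<not> b < 1) \<or> (a < 2 \<and> \<not> b < 2)" if "a \<le> 2" "b \<le> 2" for a b :: enat
      using that by (cases a; cases b) (auto simp: numeral_eq_enat one_enat_def)
    show ?thesis
      unfolding *[OF le] gdist_less_1_iff gdist_less_2_iff[OF simple]
      using w uv assms nbrs_sym[of u H w] nbrs_sym[of v H w] nbrs_sym[of u H v] by auto
  qed
  then show ?thesis
    unfolding closer_def using uv nbrs_simple(2)[OF simple] by auto
qed

text \<open>The common neighbours are symmetric in \<open>u\<close> and \<open>v\<close>, so this
  reduces balance of an edge to equality of degrees.\<close>

lemma card_closer: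
  assumes "v \<in> nbrs H u"
  shows "card (closer H u v) + card (nbrs H u \<inter> nbrs H v) = degree H u"
proof -
  note uv = nbrs_simple[OF simple assms]
  have fin: "finite (nbrs H u)" by (rule finite_nbrs[OF simple])
  have "u \<notin> nbrs H u" "v \<notin> nbrs H v" using nbrs_simple(3)[OF simple] by blast+
  then have "card (closer H u v) = Suc (card (nbrs H u - nbrs H v - {v}))"
    unfolding closer_eq[OF assms] using fin by simp
  \<comment> \<open>The added \<open>u\<close> makes up for the removed \<open>v\<close>, which lies
    in \<open>nbrs H u - nbrs H v\<close>.\<close>
  also have "\<dots> = card (nbrs H u - nbrs H v)"
    using fin assms \<open>v \<notin> nbrs H v\<close> by (intro card_Suc_Diff1) auto
  finally show ?thesis
    using fin card_Int_Diff[of "nbrs H u" "nbrs H v"] degree_eq_card_nbrs[OF simple] by simp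
qed

lemma balanced_edge_iff:
  assumes "v \<in> nbrs H u"
  shows "card (closer H u v) = card (closer H v u) \<longleftrightarrow> degree H u = degree H v"
  using card_closer[OF assms] card_closer[of u v] assms nbrs_sym[of u H v]
  by (auto simp: Int_commute)

lemma distance_balanced_iff: "distance_balanced H \<longleftrightarrow> regular H"
proof
  assume db: "distance_balanced H"
  have adj: "degree H u = degree H v" if "v \<in> nbrs H u" for u v
    using db that balanced_edge_iff[OF that] by (auto simp: distance_balanced_def nbrs_def)
  \<comment> \<open>Vertices at distance at most 2 are equal, adjacent or share a neighbour, through
    which the degree is passed on.\<close>
  have "degree H u = degree H v" if "u \<in> verts H" "v \<in> verts H" for u v
    using dist_le[OF that] adj[of _ u] adj[of _ v] unfolding gdist_le_2_iff[OF simple] by auto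
  then show "regular H" unfolding regular_def by blast
next
  assume "regular H"
  then obtain r where r: "degree H v = r" if "v \<in> verts H" for v
    unfolding regular_def by blast
  show "distance_balanced H"
    unfolding distance_balanced_def
  proof (intro allI impI)
    fix u v assume "{u, v} \<in> edges H"
    then have uv: "v \<in> nbrs H u" by (simp add: nbrs_def)
    then show "card (closer H u v) = card (closer H v u)"
      using balanced_edge_iff[OF uv] r nbrs_simple[OF simple uv] by simp
  qed
qed

end

section \<open>Complements of unions of cycles\<close>

text \<open>A permutation \<open>\<sigma>\<close> with all cycles of length at least 3 encodes the 2-regular graph with edges
  \<open>{v, \<sigma> v}\<close>.\<close>

definition cycle_complement :: "'a set \<Rightarrow> ('a \<Rightarrow> 'a) \<Rightarrow> 'a ugraph" where
  "cycle_complement V \<sigma> = \<lparr>verts = V,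
     edges = {{u, v} | u v. u \<in> V \<and> v \<in> V \<and> u \<noteq> v \<and> v \<noteq> \<sigma> u \<and> u \<noteq> \<sigma> v}\<rparr>"

lemma verts_cycle_complement [simp]: "verts (cycle_complement V \<sigma>) = V"
  by (simp add: cycle_complement_def)

lemma simple_cycle_complement: "finite V \<Longrightarrow> simple_graph (cycle_complement V \<sigma>)"
  by (auto simp: simple_graph_def cycle_complement_def)

lemma nbrs_cycle_complement:
  "nbrs (cycle_complement V \<sigma>) u = {v \<in> V. u \<in> V \<and> u \<noteq> v \<and> v \<noteq> \<sigma> u \<and> u \<noteq> \<sigma> v}"
  by (auto simp: nbrs_def cycle_complement_def doubleton_eq_iff)

text \<open>The non-neighbours of \<open>u\<close> are \<open>u\<close>, its image and its preimage
  under the permutation; these are distinct since there are no fixed points and no 2-cycles.\<close>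

lemma degree_cycle_complement:
  assumes "finite V" "inj_on \<sigma> V" "\<sigma> ` V \<subseteq> V" "u \<in> V"
    and "\<And>v. v \<in> V \<Longrightarrow> \<sigma> v \<noteq> v" "\<And>v. v \<in> V \<Longrightarrow> \<sigma> (\<sigma> v) \<noteq> v"
  shows "degree (cycle_complement V \<sigma>) u + 3 = card V"
proof -
  have "\<sigma> ` V = V" using assms(1-3) by (simp add: endo_inj_surj)
  then obtain w where w: "w \<in> V" "\<sigma> w = u" using assms(4) by (metis imageE)
  have "nbrs (cycle_complement V \<sigma>) u = V - {u, \<sigma> u, w}"
    using w assms(2,4) by (auto simp: nbrs_cycle_complement inj_on_def)
  moreover have sub: "{u, \<sigma> u, w} \<subseteq> V" using w assms(3,4) by auto
  moreover have "card {u, \<sigma> u, w} = 3"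
    using assms(5,6)[OF w(1)] assms(5)[OF assms(4)] w(2) by auto
  ultimately show ?thesis
    using degree_eq_card_nbrs[OF simple_cycle_complement[OF assms(1)], of \<sigma> u]
      card_mono[OF assms(1) sub] by (simp add: card_Diff_subset)
qed

section \<open>The tree\<close>

locale broom =
  fixes m :: nat and c y z :: 'a and x :: "nat \<Rightarrow> 'a" and G :: "'a ugraph"
  assumes m3: "m \<ge> 3"
    and inj: "inj_on x {1..m}"
    and dist: "distinct [c, y, z]"
    and disj: "{c, y, z} \<inter> x ` {1..m} = {}"
    and G_eq: "G = \<lparr>verts = {c, y, z} \<union> x ` {1..m},
              edges = {{c, x i} | i. i \<in> {1..m}} \<union> {{x 1, y}, {x 1, z}}\<rparr>"
begin

lemma verts_G: "verts G = {c, y, z} \<union> x ` {1..m}"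
  by (simp add: G_eq)

lemma edges_G: "edges G = (\<lambda>i. {c, x i}) ` {1..m} \<union> {{x 1, y}, {x 1, z}}"
  by (auto simp: G_eq)

lemma neq: "c \<noteq> y" "c \<noteq> z" "y \<noteq> z"
  using dist by auto

lemma x_neq: "i \<in> {1..m} \<Longrightarrow> x i \<noteq> c \<and> x i \<noteq> y \<and> x i \<noteq> z"
  using disj by auto

lemma x_eq_iff: "i \<in> {1..m} \<Longrightarrow> j \<in> {1..m} \<Longrightarrow> x i = x j \<longleftrightarrow> i = j"
  by (rule inj_on_eq_iff[OF inj])

lemma one_in: "1 \<in> {1..m}"
  using m3 by simp

lemma card_verts_G: "card (verts G) = m + 3"
proof -
  have "card ({c, y, z} \<union> x ` {1..m}) = card {c, y, z} + card (x ` {1..m})"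
    using disj by (intro card_Un_disjoint) auto
  then show ?thesis using neq card_image[OF inj] by (simp add: verts_G)
qed

lemma card_edges_G: "card (edges G) = m + 2"
proof -
  have "inj_on (\<lambda>i. {c, x i}) {1..m}"
    using x_neq x_eq_iff by (auto simp: inj_on_def doubleton_eq_iff)
  then have "card ((\<lambda>i. {c, x i}) ` {1..m}) = m" by (simp add: card_image)
  moreover have "card {{x 1, y}, {x 1, z}} = 2"
    using neq by (auto simp: doubleton_eq_iff)
  moreover have "(\<lambda>i. {c, x i}) ` {1..m} \<inter> {{x 1, y}, {x 1, z}} = {}"
    using neq x_neq[OF one_in] by (auto simp: doubleton_eq_iff)
  ultimately show ?thesis
    unfolding edges_G by (subst card_Un_disjoint) auto
qed

lemma finite_edges_G: "finite (edges G)"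
  by (simp add: edges_G)

section \<open>Distance-balanced supergraphs of the tree\<close>

context
  fixes H :: "'a ugraph"
  assumes simple: "simple_graph H" and span: "spanning_subgraph G H"
begin

lemma verts_H: "verts H = {c, y, z} \<union> x ` {1..m}"
  using span by (simp add: spanning_subgraph_def verts_G)

lemma x_nbrs_c: "i \<in> {1..m} \<Longrightarrow> x i \<in> nbrs H c"
  using span by (auto simp: spanning_subgraph_def edges_G nbrs_def)

lemma leaf_nbrs: "p \<in> {y, z} \<Longrightarrow> p \<in> nbrs H (x 1)"
  using span by (auto simp: spanning_subgraph_def edges_G nbrs_def)

lemma gdist_leaf_le:
  assumes db: "distance_balanced H" and i: "i \<in> {1..m}" and p: "p \<in> {y, z}"
  shows "gdist H p (x i) \<le> 2"
proof (rule ccontr)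
  assume far: "\<not> gdist H p (x i) \<le> 2"
  note far' = far[unfolded gdist_le_2_iff[OF simple]]
  have neq1: "x i \<noteq> x 1" using far' leaf_nbrs[OF p] nbrs_sym by metis
  have pV: "p \<in> verts H" "p \<noteq> c" "p \<noteq> x 1"
    using p neq x_neq[OF one_in] by (auto simp: verts_H)
  have V: "c \<in> verts H" "x i \<in> verts H" "x 1 \<in> verts H"
    using i one_in by (auto simp: verts_H)
  have "p \<in> closer H c (x i)"
  proof -
    have "gdist H p c \<le> 2"
      unfolding gdist_le_2_iff[OF simple] using leaf_nbrs[OF p] x_nbrs_c[OF one_in] nbrs_sym by fast
    then show ?thesis using far pV by (simp add: closer_def)
  qed
  moreover have "x 1 \<in> closer H c (x i)"
  proof -
    \<comment> \<open>Otherwise \<open>x 1\<close> would be a common neighbour of \<open>p\<close>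
      and \<open>x i\<close>.\<close>
    have "x i \<notin> nbrs H (x 1)" using far' leaf_nbrs[OF p] nbrs_sym by fast
    then have "\<not> gdist H (x 1) (x i) < 2"
      unfolding gdist_less_2_iff[OF simple] using neq1 by auto
    moreover have "gdist H (x 1) c < 2"
      unfolding gdist_less_2_iff[OF simple] using x_nbrs_c[OF one_in] nbrs_sym by fast
    ultimately show ?thesis using V by (simp add: closer_def)
  qed
  moreover have "c \<in> closer H c (x i)"
  proof -
    have "gdist H c c < 1" "\<not> gdist H c (x i) < 1"
      unfolding gdist_less_1_iff using V x_neq[OF i] by auto
    then show ?thesis using V by (simp add: closer_def)
  qed
  ultimately have "{p, x 1, c} \<subseteq> closer H c (x i)" by blast
  moreover have "finite (closer H c (x i))"
    using simple by (simp add: closer_def simple_graph_def)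
  ultimately have "card {p, x 1, c} \<le> card (closer H c (x i))" by (intro card_mono)
  moreover have "card {p, x 1, c} = 3" using pV x_neq[OF one_in] by auto
  ultimately have ge: "3 \<le> card (closer H c (x i))" by simp

  \<comment> \<open>Both \<open>p\<close> and \<open>c\<close> are on the other side. Any
    \<open>x j\<close> is within distance 1 of \<open>c\<close>, hence on this side only if it
    equals \<open>x i\<close>. What remains is the other leaf.\<close>
  have "closer H (x i) c \<subseteq> insert (x i) ({y, z} - {p})"
  proof
    fix w assume w: "w \<in> closer H (x i) c"
    then have lt: "gdist H w (x i) < gdist H w c" and wV: "w \<in> verts H"
      by (auto simp: closer_def)
    have "w \<noteq> p" using w \<open>p \<in> closer H c (x i)\<close> by (auto simp: closer_def)
    moreover have "w \<noteq> c" using w \<open>c \<in> closer H c (x i)\<close> by (auto simp: closer_def)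
    moreover have "w = x i" if w': "w \<in> x ` {1..m}"
    proof -
      have "gdist H w c < 2"
        unfolding gdist_less_2_iff[OF simple] using w' x_nbrs_c nbrs_sym by fast
      with lt have "gdist H w (x i) < 1"
        by (cases "gdist H w (x i)"; cases "gdist H w c") (auto simp: numeral_eq_enat one_enat_def)
      then show ?thesis by (simp add: gdist_less_1_iff)
    qed
    ultimately show "w \<in> insert (x i) ({y, z} - {p})" using wV by (auto simp: verts_H)
  qed
  then have "card (closer H (x i) c) \<le> card (insert (x i) ({y, z} - {p}))"
    by (intro card_mono) auto
  also have "\<dots> \<le> 2" using p neq by (auto simp: card_insert_if)
  finally show False
    using db[unfolded distance_balanced_def, rule_format, of c "x i"] x_nbrs_c[OF i] ge
    by (simp add: nbrs_def)
qed

text \<open>For pairs other than a leaf and some \<open>x i\<close>, the tree alone suffices: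
  \<open>c\<close> joins the \<open>x i\<close>, and \<open>x 1\<close> joins the leaves to each
  other and to \<open>c\<close>.\<close>

lemma diam2_H:
  assumes "distance_balanced H"
  shows "diam2_graph H"
proof
  fix u v assume u: "u \<in> verts H" and v: "v \<in> verts H"
  note le = gdist_le_2_iff[OF simple]
  have leaf_x: "gdist H p (x i) \<le> 2" "gdist H (x i) p \<le> 2" if "i \<in> {1..m}" "p \<in> {y, z}" for i p
  proof -
    show 1: "gdist H p (x i) \<le> 2" using gdist_leaf_le[OF assms that] .
    show "gdist H (x i) p \<le> 2" using 1 that one_in unfolding le
      by (metis Int_commute nbrs_sym)
  qed
  have leaf_c: "gdist H p c \<le> 2" "gdist H c p \<le> 2" if "p \<in> {y, z}" for p
    unfolding le using leaf_nbrs[OF that] x_nbrs_c[OF one_in] nbrs_sym by fast+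
  have leaf_leaf: "gdist H p q \<le> 2" if "p \<in> {y, z}" "q \<in> {y, z}" for p q
    unfolding le using leaf_nbrs[OF that(1)] leaf_nbrs[OF that(2)] nbrs_sym by fast
  have c_x: "gdist H c (x i) \<le> 2" "gdist H (x i) c \<le> 2" if "i \<in> {1..m}" for i
    unfolding le using x_nbrs_c[OF that] nbrs_sym by fast+
  have x_x: "gdist H (x i) (x j) \<le> 2" if "i \<in> {1..m}" "j \<in> {1..m}" for i j
    unfolding le using x_nbrs_c[OF that(1)] x_nbrs_c[OF that(2)] nbrs_sym by fast
  have c_c: "gdist H c c \<le> 2" unfolding le by (simp add: verts_H)
  have part: "w = c \<or> w \<in> {y, z} \<or> (\<exists>i\<in>{1..m}. w = x i)" if "w \<in> verts H" for w
    using that unfolding verts_H by blast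
  show "gdist H u v \<le> 2"
    using part[OF u] part[OF v]
    by (elim disjE bexE; simp only: leaf_x leaf_c leaf_leaf c_x x_x c_c)
qed (rule simple)

lemma diam_le_2_regular:
  assumes "distance_balanced H"
  shows "diam H \<le> 2" "regular H"
proof -
  interpret diam2_graph H by (rule diam2_H[OF assms])
  show "diam H \<le> 2" using dist_le by (subst diam_le_iff[OF simple]) (auto simp: verts_H)
  show "regular H" using assms by (simp add: distance_balanced_iff)
qed

lemma card_edges_ge:
  assumes "distance_balanced H"
  shows "(m + 3) * m \<le> 2 * card (edges H)"
proof -
  obtain r where r: "\<And>v. v \<in> verts H \<Longrightarrow> degree H v = r"
    using diam_le_2_regular(2)[OF assms] by (auto simp: regular_def)
  have "m = card (x ` {1..m})" using card_image[OF inj] by simp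
  also have "\<dots> \<le> card (nbrs H c)"
    using x_nbrs_c by (intro card_mono finite_nbrs simple) auto
  also have "\<dots> = r" using r degree_eq_card_nbrs[OF simple] by (simp add: verts_H)
  finally have "m \<le> r" .
  moreover have "card (verts H) = m + 3"
    using card_verts_G span by (simp add: spanning_subgraph_def)
  then have "2 * card (edges H) = (m + 3) * r"
    using handshake[OF simple] r by simp
  ultimately show ?thesis by simp
qed

end

section \<open>The extremal graph\<close>

text \<open>On the vertices of \<open>G\<close> this is the permutation with cycles
  \<open>c, y, z\<close> and \<open>x 1, ..., x m\<close>; \<open>the_inv_into\<close> recovers the
  index of a vertex \<open>x i\<close>.\<close>

definition succ :: "'a \<Rightarrow> 'a" where
  "succ v = (if v = c then y else if v = y then z else if v = z then c
     else if v = x m then x 1 else x (Suc (the_inv_into {1..m} x v)))"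

lemma succ_simps:
  "succ c = y" "succ y = z" "succ z = c"
  "i \<in> {1..m} \<Longrightarrow> succ (x i) = x (if i = m then 1 else Suc i)"
  using neq x_neq x_eq_iff[of i m] m3 the_inv_into_f_f[OF inj, of i] by (auto simp: succ_def)

definition extremal :: "'a ugraph" where
  "extremal = cycle_complement (verts G) succ"

lemma verts_extremal: "verts extremal = verts G"
  by (simp add: extremal_def)

lemma simple_extremal: "simple_graph extremal"
  unfolding extremal_def by (rule simple_cycle_complement) (simp add: verts_G)

lemma degree_extremal:
  assumes "u \<in> verts G"
  shows "degree extremal u = m"
proof -
  \<comment> \<open>The cyclic shift of indices. That \<open>s (s i)\<close> differs from
    \<open>i\<close> relies on \<open>m\<close> being at least 3.\<close>
  define s where "s i = (if i = m then 1 else Suc i)" for i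
  have s: "s i \<in> {1..m}" "s i \<noteq> i" "s (s i) \<noteq> i" if "i \<in> {1..m}" for i
    using that m3 unfolding s_def by (cases "i = m"; cases "Suc i = m"; auto)+
  have s_inj: "i = j" if "i \<in> {1..m}" "j \<in> {1..m}" "s i = s j" for i j
    using that unfolding s_def by (cases "i = m"; cases "j = m") auto
  have succ_x: "succ (x i) = x (s i)" if "i \<in> {1..m}" for i
    using succ_simps(4)[OF that] by (simp add: s_def)
  have vert_cases: thesis
    if "v \<in> verts G" "v \<in> {c, y, z} \<Longrightarrow> thesis" "\<And>i. i \<in> {1..m} \<Longrightarrow> v = x i \<Longrightarrow> thesis"
    for v thesis
    using that unfolding verts_G by blast
  have "inj_on succ (verts G)"
  proof (rule inj_onI)
    fix u v assume u: "u \<in> verts G" and v: "v \<in> verts G" and eq: "succ u = succ v"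
    \<comment> \<open>A successor among the \<open>x i\<close> comes from outside the triangle, so
      \<open>succ\<close> preserves both classes and injectivity can be checked on each.\<close>
    have x_only: "u' \<notin> {c, y, z}" if "succ u' = x (s i)" "i \<in> {1..m}" for u' i
      using that x_neq[OF s(1)[OF that(2)]] by (auto simp: succ_simps(1-3))
    show "u = v"
    proof (cases rule: vert_cases[OF u])
      case 1
      then have "v \<in> {c, y, z}"
        using x_only[of u] succ_x eq by (cases rule: vert_cases[OF v]) auto
      then show ?thesis using 1 eq neq by (auto simp: succ_simps(1-3))
    next
      case (2 i)
      then obtain j where "j \<in> {1..m}" "v = x j"
        using x_only[of v i] succ_x eq by (cases rule: vert_cases[OF v]) auto
      then show ?thesis using 2 eq succ_x x_eq_iff s s_inj by metis
    qed
  qed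
  moreover have "succ ` verts G \<subseteq> verts G"
    unfolding verts_G using s(1) by (auto simp: succ_simps(1-3) succ_x simp del: atLeastAtMost_iff)
  moreover have "succ v \<noteq> v \<and> succ (succ v) \<noteq> v" if "v \<in> verts G" for v
  proof (cases rule: vert_cases[OF that])
    case 1
    then show ?thesis using neq by (auto simp: succ_simps(1-3))
  next
    case (2 i)
    then show ?thesis using s x_eq_iff by (simp add: succ_x del: atLeastAtMost_iff)
  qed
  ultimately have "degree extremal u + 3 = card (verts G)"
    unfolding extremal_def using assms by (intro degree_cycle_complement) (auto simp: verts_G)
  then show ?thesis by (simp add: card_verts_G)
qed

text \<open>Both classes are closed under \<open>succ\<close>, so no removed edge runs between them.
  This yields both the diameter bound and the containment of the tree, whose edges all run between
  the classes.\<close>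

lemma extremal_join:
  assumes "p \<in> {c, y, z}" "i \<in> {1..m}"
  shows "x i \<in> nbrs extremal p" "p \<in> nbrs extremal (x i)"
proof -
  have "succ p \<in> {c, y, z}" using assms(1) by (auto simp: succ_simps(1-3))
  then have "x i \<noteq> succ p" "x i \<noteq> p" using x_neq[OF assms(2)] assms(1) by auto
  moreover have "p \<noteq> succ (x i)"
  proof -
    have "(if i = m then 1 else Suc i) \<in> {1..m}" using assms(2) by simp
    from x_neq[OF this] show ?thesis using assms(1) unfolding succ_simps(4)[OF assms(2)] by blast
  qed
  moreover have "p \<in> verts G" "x i \<in> verts G" using assms unfolding verts_G by blast+
  ultimately show 1: "x i \<in> nbrs extremal p"
    unfolding extremal_def nbrs_cycle_complement by simp
  show "p \<in> nbrs extremal (x i)" using 1 nbrs_sym by fast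
qed

lemma diam2_extremal: "diam2_graph extremal"
proof
  fix u v assume uv: "u \<in> verts extremal" "v \<in> verts extremal"
  have part: "w \<in> {c, y, z} \<or> w \<in> x ` {1..m}" if "w \<in> verts extremal" for w
    using that unfolding verts_extremal verts_G by blast
  have join: "w \<in> nbrs extremal p" "p \<in> nbrs extremal w" if "p \<in> {c, y, z}" "w \<in> x ` {1..m}" for p w
    using that extremal_join by blast+
  \<comment> \<open>Any two vertices of one class have a common neighbour in the other class:
    \<open>x 1\<close> for the triangle, \<open>c\<close> for the \<open>x i\<close>.\<close>
  have base: "c \<in> {c, y, z}" "x 1 \<in> x ` {1..m}" using one_in by blast+
  have "v \<in> nbrs extremal u \<or> (\<exists>w. w \<in> nbrs extremal u \<and> w \<in> nbrs extremal v)"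
    using part[OF uv(1)]
  proof
    assume u: "u \<in> {c, y, z}"
    show ?thesis
      using part[OF uv(2)] join(1)[OF u] join(1)[OF _ base(2)] u by meson
  next
    assume u: "u \<in> x ` {1..m}"
    show ?thesis
      using part[OF uv(2)] join(2)[OF _ u] join(2)[OF base(1)] u by meson
  qed
  then show "gdist extremal u v \<le> 2"
    unfolding gdist_le_2_iff[OF simple_extremal] by blast
qed (rule simple_extremal)

lemma distance_balanced_extremal: "distance_balanced extremal"
proof -
  interpret diam2_graph extremal by (rule diam2_extremal)
  show ?thesis
    unfolding distance_balanced_iff using degree_extremal by (auto simp: regular_def verts_extremal)
qed

lemma edges_G_extremal: "edges G \<subseteq> edges extremal"
proof -
  have "{c, x i} \<in> edges extremal" if "i \<in> {1..m}" for i
    using extremal_join(1)[OF _ that] by (simp add: nbrs_def)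
  moreover have "{x 1, y} \<in> edges extremal" "{x 1, z} \<in> edges extremal"
    using extremal_join(2)[OF _ one_in] by (simp_all add: nbrs_def)
  ultimately show ?thesis by (auto simp: edges_G)
qed

lemma card_edges_extremal: "2 * card (edges extremal) = (m + 3) * m"
  using handshake[OF simple_extremal] degree_extremal card_verts_G by (simp add: verts_extremal)

text \<open>The \<open>m + 2\<close> tree edges plus the fewest added ones give the least size of a
  distance-balanced supergraph. This form avoids truncated subtraction and division on
  naturals.\<close>

lemma b_number_G: "2 * (m + 2 + b_number G) = (m + 3) * m"
proof -
  define F where "F = edges extremal - edges G"
  have cF: "m + 2 + card F = card (edges extremal)"
    using card_Diff_subset[OF finite_edges_G edges_G_extremal]
      card_mono[OF finite_edges[OF simple_extremal] edges_G_extremal]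
    by (simp add: F_def card_edges_G)
  have ext: "\<lparr>verts = verts G, edges = edges G \<union> F\<rparr> = extremal"
    using edges_G_extremal by (simp add: F_def extremal_def cycle_complement_def Un_absorb1)
  have "b_number G = card F"
    unfolding b_number_def
  proof (rule Least_equality)
    show "\<exists>F'. F' \<inter> edges G = {} \<and> card F' = card F \<and>
        simple_graph \<lparr>verts = verts G, edges = edges G \<union> F'\<rparr> \<and>
        distance_balanced \<lparr>verts = verts G, edges = edges G \<union> F'\<rparr>"
      by (rule exI[of _ F], unfold ext)
        (simp add: simple_extremal distance_balanced_extremal, auto simp: F_def)
  next
    fix k
    assume "\<exists>F'. F' \<inter> edges G = {} \<and> card F' = k \<and>
        simple_graph \<lparr>verts = verts G, edges = edges G \<union> F'\<rparr> \<and>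
        distance_balanced \<lparr>verts = verts G, edges = edges G \<union> F'\<rparr>"
    then obtain F' where F': "F' \<inter> edges G = {}" "card F' = k"
      and simple: "simple_graph \<lparr>verts = verts G, edges = edges G \<union> F'\<rparr>" (is "simple_graph ?H")
      and db: "distance_balanced \<lparr>verts = verts G, edges = edges G \<union> F'\<rparr>"
      by blast
    \<comment> \<open>Any competing \<open>F'\<close> is disjoint from the tree, so its graph has
      exactly \<open>m + 2 + k\<close> edges and the lower bound applies.\<close>
    have "spanning_subgraph G ?H" by (simp add: spanning_subgraph_def)
    then have "(m + 3) * m \<le> 2 * card (edges ?H)" using card_edges_ge simple db by blast
    also have "card (edges ?H) = m + 2 + k"
      using F' finite_edges[OF simple] finite_edges_G card_edges_G
      by (simp add: card_Un_disjoint Int_commute)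
    finally show "card F \<le> k" using cF card_edges_extremal by simp
  qed
  then show ?thesis using cF card_edges_extremal by simp
qed

end

theorem theorem4p3:
  fixes m :: nat
    and c y z :: 'a
    and x :: "nat \<Rightarrow> 'a"
    and G :: "'a ugraph"
  assumes "m \<ge> 3"
    and "inj_on x {1..m}"
    and "distinct [c, y, z]"
    and "{c, y, z} \<inter> x ` {1..m} = {}"
    and "G = \<lparr>verts = {c, y, z} \<union> x ` {1..m},
              edges = {{c, x i} | i. i \<in> {1..m}} \<union> {{x 1, y}, {x 1, z}}\<rparr>"
  shows "(\<forall>H. simple_graph H \<and> distance_balanced H \<and> spanning_subgraph G H \<longrightarrow>
            diam H \<le> 2 \<and> regular H) \<and>
         real (b_number G) = (real m ^ 2 + real m - 4) / 2"
proof -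
  interpret broom m c y z x G using assms by unfold_locales
  \<comment> \<open>The identity is moved to the reals before the subtraction is introduced.\<close>
  have "2 * (real m + 2 + real (b_number G)) = (real m + 3) * real m"
    using arg_cong[OF b_number_G, of real] by simp
  then have "real (b_number G) = (real m ^ 2 + real m - 4) / 2"
    by (simp add: power2_eq_square algebra_simps)
  then show ?thesis using diam_le_2_regular by blast
qed

end
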